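(* Let $(G,X)$ be a sharply $2$-transitive group with $|X|\geq 3$, fix $x\in X$, and let $H=\{g\in G : gx=x\}$ be the stabilizer of $x$. If $\operatorname{char}(G)=3$, then $G$ splits, i.e. there is a normal subgroup $N$ of $G$ such that $G=NH$ and $N\cap H=\{1\}$.
   Context: A sharply $2$-transitive group is a pair $(G,X)$ where $G$ is a group (possibly infinite) acting on the set $X$ in such a way that for all $x,y,z,t\in X$ with $x\neq y$ and $z\neq t$ there is a unique $g\in G$ with $gx=z$ and $gy=t$. Assume $|X|\geq 3$, fix $x\in X$, and let $H=\{g\in G: gx=x\}$ be the stabilizer of $x$. Let $I$ be the set of involutions (elements of order exactly $2$) of $G$, and let $I^2=\{ij : i,j\in I\}$ be the set of products of two involutions. Characteristic: if $H$ has no involution, one says $\operatorname{char}(G)=2$. If $H$ has an involution (that is, $\operatorname{char}(G)\neq 2$), then it is known that $I^2\setminus\{1\}$ is a single conjugacy class of $G$, and either all nontrivial elements of $I^2$ have order $p$ for one prime $p\neq 2$, in which case one writes $\operatorname{char}(G)=p$, or $I^2$ has no nontrivial element of finite order, in which case one writes $\operatorname{char}(G)=0$. In particular, $\operatorname{char}(G)=3$ means that $H$ contains an involution and every nontrivial element of $I^2$ has order $3$. $G$ splits if the one-point stabilizer $H$ has a normal complement in $G$, i.e. there is a normal subgroup $N$ of $G$ with $G=NH$ and $N\cap H=\{1\}$. *)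

theory Defs
  imports
    "HOL-Algebra.Group_Action"
    "HOL-Algebra.Multiplicative_Group"
    "HOL-Computational_Algebra.Primes"
begin

locale sharply_2_transitive = group_action G E \<phi>
  for G (structure) and E and \<phi> +
  assumes sharp: "\<lbrakk>x \<in> E; y \<in> E; z \<in> E; t \<in> E; x \<noteq> y; z \<noteq> t\<rbrakk>
    \<Longrightarrow> \<exists>!g. g \<in> carrier G \<and> \<phi> g x = z \<and> \<phi> g y = t"

definition involutions :: "('a, 'm) monoid_scheme \<Rightarrow> 'a set" where
  "involutions G = {g \<in> carrier G. group.ord G g = 2}"

text \<open>
  The characteristic is a relation between the group and the natural number \<open>p\<close>. The library's
  \<open>ord\<close> is \<open>0\<close> exactly on the elements of infinite order.
\<close>

definition has_char ::
  "('a, 'm) monoid_scheme \<Rightarrow> ('a \<Rightarrow> 'b \<Rightarrow> 'b) \<Rightarrow> 'b \<Rightarrow> nat \<Rightarrow> bool" where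
  "has_char G \<phi> x p \<longleftrightarrow>
     (if stabilizer G \<phi> x \<inter> involutions G = {} then p = 2
      else (p = 0 \<or> prime p \<and> p \<noteq> 2) \<and>
           (\<forall>g \<in> (involutions G <#>\<^bsub>G\<^esub> involutions G) - {\<one>\<^bsub>G\<^esub>}. group.ord G g = p))"

definition has_normal_complement :: "('a, 'm) monoid_scheme \<Rightarrow> 'a set \<Rightarrow> bool" where
  "has_normal_complement G H \<longleftrightarrow>
     (\<exists>N. N \<lhd> G \<and> carrier G = N <#>\<^bsub>G\<^esub> H \<and> N \<inter> H = {\<one>\<^bsub>G\<^esub>})"

end

theory Submission
  imports Defs
begin

text \<open>
  As the stabilizer \<open>H\<close> contains an involution, the set \<open>I\<close> of involutions corresponds to the
  points of \<open>E\<close>: every involution fixes exactly one point, and distinct involutions fix distinct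
  points (\<open>involution_has_fixpoint\<close>, \<open>involution_eq_if_common_fixpoint\<close>). Characteristic \<open>3\<close> means
  that \<open>(i j)\<^sup>3 = \<one>\<close> for all \<open>i, j \<in> I\<close>, and the claim is that \<open>N = I I\<close> is the required normal
  complement. The only real difficulty is that \<open>N\<close> is closed under multiplication.

  Let \<open>i, j, k \<in> I\<close>, \<open>a = i j\<close> and \<open>b = i k\<close>. All of \<open>a\<close>, \<open>b\<close>, \<open>a b\<close> and \<open>a b\<^sup>-\<^sup>1\<close> are, up to
  conjugation, products of two involutions, hence have a trivial cube. These are the relations
  presenting the group of order \<open>27\<close> and exponent \<open>3\<close>, in which the commutator \<open>c\<close> of \<open>a\<close> and \<open>b\<close>
  is central; as \<open>i\<close> inverts \<open>a\<close> and \<open>b\<close>, it centralizes \<open>c\<close> as well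
  (\<open>commutator_centralized\<close>). So \<open>c\<close> commutes with \<open>i\<close> and with \<open>j = i a\<close>, and therefore fixes the
  fixed points of both. If \<open>i \<noteq> j\<close> these are two points, and sharpness gives \<open>c = \<one>\<close>
  (\<open>centralizer_of_two_involutions\<close>); if \<open>i = j\<close>, then \<open>a = \<one>\<close>. In either case
  \<open>a b = b a\<close>, which says that \<open>j i k = k i j\<close>, so a product of three involutions is its own inverse; it
  is not \<open>\<one>\<close>, so it is again an involution (\<open>triple_mem\<close>). Thus
  \<open>I I I I \<subseteq> I I\<close>, and \<open>N\<close> is a subgroup. It meets \<open>H\<close> trivially, since a nontrivial \<open>i j\<close> fixing
  \<open>x\<close> would fix the images of \<open>x\<close> under \<open>i\<close> and \<open>j\<close> too, which makes \<open>x\<close> the common fixed point of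
  \<open>i\<close> and \<open>j\<close>; and it is transitive, since any two points are swapped by an involution.
\<close>

section \<open>Elements of order three in a group\<close>

context group
begin

lemma inv_cancel_left [simp]:
  assumes "x \<in> carrier G" "y \<in> carrier G"
  shows "inv x \<otimes> (x \<otimes> y) = y" "x \<otimes> (inv x \<otimes> y) = y"
  using assms by (simp_all flip: m_assoc)

lemma involution_cancel_left:
  assumes "x \<in> carrier G" "x \<otimes> x = \<one>" "y \<in> carrier G"
  shows "x \<otimes> (x \<otimes> y) = y"
  using assms by (simp flip: m_assoc)

lemma inv_involution:
  assumes "x \<in> carrier G" "x \<otimes> x = \<one>"
  shows "inv x = x"
  using assms by (metis inv_equality)

lemma cube_inv:
  assumes "b \<in> carrier G" "b \<otimes> (b \<otimes> b) = \<one>"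
  shows "b \<otimes> b = inv b"
  using assms by (metis inv_equality m_assoc m_closed)

lemma inverts_inv:
  assumes "i \<in> carrier G" "b \<in> carrier G" "i \<otimes> b = inv b \<otimes> i"
  shows "i \<otimes> inv b = b \<otimes> i"
proof -
  have "b \<otimes> (i \<otimes> b) \<otimes> inv b = b \<otimes> (inv b \<otimes> i) \<otimes> inv b"
    using assms(3) by simp
  then show ?thesis
    using assms(1,2) by (simp add: m_assoc)
qed

lemma cube_conj:
  assumes "g \<in> carrier G" "h \<in> carrier G" "h \<otimes> (h \<otimes> h) = \<one>"
  shows "(g \<otimes> h \<otimes> inv g) \<otimes> ((g \<otimes> h \<otimes> inv g) \<otimes> (g \<otimes> h \<otimes> inv g)) = \<one>"
proof -
  have "(g \<otimes> h \<otimes> inv g) \<otimes> ((g \<otimes> h \<otimes> inv g) \<otimes> (g \<otimes> h \<otimes> inv g)) = g \<otimes> (h \<otimes> (h \<otimes> h)) \<otimes> inv g"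
    using assms(1,2) by (simp add: m_assoc)
  then show ?thesis
    using assms by simp
qed

text \<open>
  The cubes of \<open>a b\<close> and \<open>a b\<^sup>-\<^sup>1\<close>, regrouped as products of conjugates of \<open>a\<close> by powers of \<open>b\<close>,
  say that the three conjugates have product \<open>\<one>\<close> in both cyclic orders; so they commute. The third
  conjugate, by \<open>b\<^sup>2\<close>, appears as \<open>v\<close> since \<open>b\<^sup>3 = \<one>\<close>.
\<close>

lemma conjugates_product:
  assumes [simp]: "a \<in> carrier G" "b \<in> carrier G"
    and b3: "b \<otimes> (b \<otimes> b) = \<one>"
    and ab3: "(a \<otimes> b) \<otimes> ((a \<otimes> b) \<otimes> (a \<otimes> b)) = \<one>"
    and ab3': "(a \<otimes> inv b) \<otimes> ((a \<otimes> inv b) \<otimes> (a \<otimes> inv b)) = \<one>"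
  defines "u \<equiv> b \<otimes> a \<otimes> inv b" and "v \<equiv> inv b \<otimes> a \<otimes> b"
  shows "a \<otimes> (u \<otimes> v) = \<one>" "a \<otimes> (v \<otimes> u) = \<one>"
proof -
  have bb: "b \<otimes> b = inv b"
    using b3 by (simp add: cube_inv)
  have bb': "inv b \<otimes> inv b = b"
    using bb by (metis assms(2) inv_inv inv_mult_group)
  have "a \<otimes> (u \<otimes> v) = a \<otimes> b \<otimes> (a \<otimes> (inv b \<otimes> inv b) \<otimes> (a \<otimes> b))"
    by (simp add: u_def v_def m_assoc)
  then show "a \<otimes> (u \<otimes> v) = \<one>"
    using ab3 by (simp add: bb')
  have "a \<otimes> (v \<otimes> u) = a \<otimes> inv b \<otimes> (a \<otimes> (b \<otimes> b) \<otimes> (a \<otimes> inv b))"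
    by (simp add: u_def v_def m_assoc)
  then show "a \<otimes> (v \<otimes> u) = \<one>"
    using ab3' by (simp add: bb)
qed

text \<open>
  With \<open>u = b a b\<^sup>-\<^sup>1\<close> and \<open>v = b\<^sup>-\<^sup>1 a b\<close>, the commutator is \<open>c = a u\<^sup>-\<^sup>1\<close>, a product of
  two commuting elements. Conjugation by \<open>i\<close> sends \<open>a\<close> to \<open>a\<^sup>-\<^sup>1\<close> and \<open>u\<close> to \<open>v\<^sup>-\<^sup>1\<close>, hence \<open>c\<close>
  to \<open>a\<^sup>-\<^sup>1 v = a\<^sup>-\<^sup>2 u\<^sup>-\<^sup>1\<close>, which is \<open>c\<close> because \<open>a\<^sup>3 = \<one>\<close>.
\<close>

lemma commutator_centralized:
  assumes [simp]: "a \<in> carrier G" "b \<in> carrier G" "i \<in> carrier G"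
    and a3: "a \<otimes> (a \<otimes> a) = \<one>"
    and b3: "b \<otimes> (b \<otimes> b) = \<one>"
    and ab3: "(a \<otimes> b) \<otimes> ((a \<otimes> b) \<otimes> (a \<otimes> b)) = \<one>"
    and ab3': "(a \<otimes> inv b) \<otimes> ((a \<otimes> inv b) \<otimes> (a \<otimes> inv b)) = \<one>"
    and ia: "i \<otimes> a = inv a \<otimes> i" and ib: "i \<otimes> b = inv b \<otimes> i"
  defines "c \<equiv> a \<otimes> (b \<otimes> inv a \<otimes> inv b)"
  shows "a \<otimes> c = c \<otimes> a" "i \<otimes> c = c \<otimes> i"
proof -
  define u where "u = b \<otimes> a \<otimes> inv b"
  define v where "v = inv b \<otimes> a \<otimes> b"
  have [simp]: "u \<in> carrier G" "v \<in> carrier G"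
    by (simp_all add: u_def v_def)
  have uv: "a \<otimes> (u \<otimes> v) = \<one>" and vu: "a \<otimes> (v \<otimes> u) = \<one>"
    using conjugates_product[OF _ _ b3 ab3 ab3'] by (simp_all add: u_def v_def)
  have c: "c = a \<otimes> inv u"
    by (simp add: c_def u_def inv_mult_group m_assoc)
  have inv_uv: "inv a = u \<otimes> v" and inv_vu: "inv a = v \<otimes> u"
    using arg_cong[OF inv_equality[OF uv], of "m_inv G"]
      arg_cong[OF inv_equality[OF vu], of "m_inv G"] by simp_all
  have au: "u \<otimes> inv a = inv a \<otimes> u"
    by (subst (1) inv_vu, subst inv_uv) (simp add: m_assoc)
  have au': "a \<otimes> inv u = inv u \<otimes> a"
    using arg_cong[OF au, of "m_inv G"] by (simp add: inv_mult_group)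
  show "a \<otimes> c = c \<otimes> a"
    by (simp add: c m_assoc flip: au')
  have ib': "i \<otimes> inv b = b \<otimes> i"
    using inverts_inv[OF _ _ ib] by simp
  have ia': "i \<otimes> inv a = a \<otimes> i"
    using inverts_inv[OF _ _ ia] by simp
  have "i \<otimes> inv u = i \<otimes> b \<otimes> inv a \<otimes> inv b"
    by (simp add: u_def inv_mult_group m_assoc)
  also have "\<dots> = inv b \<otimes> (i \<otimes> inv a) \<otimes> inv b"
    by (simp add: ib m_assoc)
  also have "\<dots> = inv b \<otimes> a \<otimes> (i \<otimes> inv b)"
    by (simp add: ia' m_assoc)
  also have "\<dots> = v \<otimes> i"
    by (simp add: ib' v_def m_assoc)
  finally have iu: "i \<otimes> inv u = v \<otimes> i" .
  have v: "v = inv a \<otimes> inv u"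
    by (simp add: inv_vu m_assoc)
  have aa: "inv a \<otimes> inv a = a"
    using cube_inv[OF _ a3] by (metis assms(1) inv_inv inv_mult_group)
  have "i \<otimes> c = i \<otimes> a \<otimes> inv u"
    by (simp add: c m_assoc)
  also have "\<dots> = inv a \<otimes> (i \<otimes> inv u)"
    by (simp add: ia m_assoc)
  also have "\<dots> = (inv a \<otimes> inv a) \<otimes> inv u \<otimes> i"
    by (simp add: iu v m_assoc)
  finally show "i \<otimes> c = c \<otimes> i"
    by (simp add: aa c)
qed

end

section \<open>Involutions whose pairwise products have order three\<close>

lemma (in group) mem_involutions_iff:
  "i \<in> involutions G \<longleftrightarrow> i \<in> carrier G \<and> i \<otimes> i = \<one> \<and> i \<noteq> \<one>"
proof (cases "i \<in> carrier G")
  case True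
  have "i \<otimes> i = \<one> \<longleftrightarrow> ord i dvd 2"
    using pow_eq_id[OF True, of 2] True by (simp add: numeral_2_eq_2)
  moreover have "ord i dvd 2 \<longleftrightarrow> ord i = 1 \<or> ord i = 2"
    using prime_nat_iff two_is_prime_nat by auto
  ultimately show ?thesis
    using True ord_eq_1[OF True] by (auto simp: involutions_def)
qed (simp add: involutions_def)

lemma (in group) involutions_conj:
  assumes "i \<in> involutions G" "g \<in> carrier G"
  shows "g \<otimes> i \<otimes> inv g \<in> involutions G"
proof -
  have i: "i \<in> carrier G" "i \<otimes> i = \<one>" "i \<noteq> \<one>"
    using assms by (simp_all add: mem_involutions_iff)
  have "(g \<otimes> i \<otimes> inv g) \<otimes> (g \<otimes> i \<otimes> inv g) = g \<otimes> (i \<otimes> i) \<otimes> inv g"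
    using i(1) assms(2) by (simp add: m_assoc)
  moreover have "g \<otimes> i \<otimes> inv g \<noteq> \<one>"
  proof
    assume "g \<otimes> i \<otimes> inv g = \<one>"
    then have "inv g \<otimes> (g \<otimes> i \<otimes> inv g) \<otimes> g = \<one>"
      using assms(2) by simp
    then show False
      using i assms(2) by (simp add: m_assoc)
  qed
  ultimately show ?thesis
    using i assms(2) by (simp add: mem_involutions_iff)
qed

text \<open>
  The centralizer assumption is the form in which sharp \<open>2\<close>-transitivity enters the closure of
  \<open>I I\<close> under multiplication; it makes that closure a statement about the abstract group.
\<close>

locale cubic_involutions = group +
  assumes cube: "\<lbrakk>i \<in> involutions G; j \<in> involutions G\<rbrakk> \<Longrightarrow> (i \<otimes> j) \<otimes> ((i \<otimes> j) \<otimes> (i \<otimes> j)) = \<one>"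
    and centralizer: "\<lbrakk>i \<in> involutions G; j \<in> involutions G; i \<noteq> j; c \<in> carrier G;
      i \<otimes> c = c \<otimes> i; j \<otimes> c = c \<otimes> j\<rbrakk> \<Longrightarrow> c = \<one>"
begin

text \<open>The commutator of \<open>i j\<close> and \<open>i k\<close> centralizes both \<open>i\<close> and \<open>i j\<close>, hence also \<open>j\<close>.\<close>

lemma products_commute:
  assumes i: "i \<in> involutions G" and j: "j \<in> involutions G" and k: "k \<in> involutions G"
    and "i \<noteq> j"
  shows "(i \<otimes> j) \<otimes> (i \<otimes> k) = (i \<otimes> k) \<otimes> (i \<otimes> j)"
proof -
  have [simp]: "i \<in> carrier G" "j \<in> carrier G" "k \<in> carrier G"
    and [simp]: "i \<otimes> i = \<one>" "j \<otimes> j = \<one>" "k \<otimes> k = \<one>"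
    using i j k by (simp_all add: mem_involutions_iff)
  have [simp]: "inv i = i" "inv j = j" "inv k = k"
    by (simp_all add: inv_involution)
  have [simp]: "i \<otimes> (i \<otimes> y) = y" "j \<otimes> (j \<otimes> y) = y" "k \<otimes> (k \<otimes> y) = y" if "y \<in> carrier G" for y
    using that by (simp_all add: involution_cancel_left)
  define a where "a = i \<otimes> j"
  define b where "b = i \<otimes> k"
  define c where "c = a \<otimes> (b \<otimes> inv a \<otimes> inv b)"
  have [simp]: "a \<in> carrier G" "b \<in> carrier G" "c \<in> carrier G"
    by (simp_all add: a_def b_def c_def)
  have inverses: "inv a = j \<otimes> i" "inv b = k \<otimes> i"
    by (simp_all add: a_def b_def inv_mult_group)
  have a3: "a \<otimes> (a \<otimes> a) = \<one>" and b3: "b \<otimes> (b \<otimes> b) = \<one>"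
    unfolding a_def b_def by (rule cube[OF i j], rule cube[OF i k])
  \<comment> \<open>\<open>a b = (i j i) k\<close>, and \<open>a b\<^sup>-\<^sup>1\<close> is the conjugate of \<open>j k\<close> by \<open>i\<close>\<close>
  have "a \<otimes> b = (i \<otimes> j \<otimes> inv i) \<otimes> k"
    by (simp add: a_def b_def m_assoc)
  then have ab3: "(a \<otimes> b) \<otimes> ((a \<otimes> b) \<otimes> (a \<otimes> b)) = \<one>"
    using cube[OF involutions_conj[OF j, of i] k] by simp
  have "a \<otimes> inv b = i \<otimes> (j \<otimes> k) \<otimes> inv i"
    by (simp add: inverses) (simp add: a_def m_assoc)
  then have ab3': "(a \<otimes> inv b) \<otimes> ((a \<otimes> inv b) \<otimes> (a \<otimes> inv b)) = \<one>"
    using cube_conj[OF _ _ cube[OF j k], of i] by simp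
  have ia: "i \<otimes> a = inv a \<otimes> i" and ib: "i \<otimes> b = inv b \<otimes> i"
    by (simp_all add: inverses) (simp_all add: a_def b_def m_assoc)
  have ac: "a \<otimes> c = c \<otimes> a" and ic: "i \<otimes> c = c \<otimes> i"
    using commutator_centralized[OF _ _ _ a3 b3 ab3 ab3' ia ib] by (simp_all add: c_def)
  have ja: "j = i \<otimes> a"
    by (simp add: a_def)
  have "j \<otimes> c = i \<otimes> (c \<otimes> a)"
    by (subst ja) (simp add: m_assoc ac)
  also have "\<dots> = i \<otimes> c \<otimes> a"
    by (simp add: m_assoc)
  also have "\<dots> = c \<otimes> j"
    by (subst ja) (simp add: ic flip: m_assoc)
  finally have "c = \<one>"
    using centralizer[OF i j \<open>i \<noteq> j\<close> _ ic] by simp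
  moreover have "a \<otimes> b = c \<otimes> (b \<otimes> a)"
    by (simp add: c_def m_assoc)
  ultimately have "a \<otimes> b = b \<otimes> a"
    by simp
  then show ?thesis
    by (simp add: a_def b_def)
qed

text \<open>
  Cancelling \<open>i\<close> in \<open>(i j) (i k) = (i k) (i j)\<close> gives \<open>j i k = k i j\<close>, the inverse of \<open>j i k\<close>.
\<close>

lemma triple_mem:
  assumes j: "j \<in> involutions G" and i: "i \<in> involutions G" and k: "k \<in> involutions G"
  shows "j \<otimes> i \<otimes> k \<in> involutions G"
proof (cases "i = j")
  case True
  then show ?thesis
    using i k by (simp add: mem_involutions_iff)
next
  case False
  have [simp]: "i \<in> carrier G" "j \<in> carrier G" "k \<in> carrier G"
    and [simp]: "i \<otimes> i = \<one>" "j \<otimes> j = \<one>" "k \<otimes> k = \<one>"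
    using i j k by (simp_all add: mem_involutions_iff)
  have [simp]: "i \<otimes> (i \<otimes> y) = y" "j \<otimes> (j \<otimes> y) = y" "k \<otimes> (k \<otimes> y) = y" if "y \<in> carrier G" for y
    using that by (simp_all add: involution_cancel_left)
  have "i \<otimes> (j \<otimes> i \<otimes> k) = i \<otimes> (k \<otimes> i \<otimes> j)"
    using products_commute[OF i j k False] by (simp add: m_assoc)
  then have eq: "j \<otimes> i \<otimes> k = k \<otimes> i \<otimes> j"
    by simp
  have "(j \<otimes> i \<otimes> k) \<otimes> (j \<otimes> i \<otimes> k) = (j \<otimes> i \<otimes> k) \<otimes> (k \<otimes> i \<otimes> j)"
    by (simp only: eq)
  also have "\<dots> = \<one>"
    by (simp add: m_assoc)
  finally have square: "(j \<otimes> i \<otimes> k) \<otimes> (j \<otimes> i \<otimes> k) = \<one>" .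
  have "j \<otimes> i \<otimes> k \<noteq> \<one>"
  proof
    assume "j \<otimes> i \<otimes> k = \<one>"
    then have "j \<otimes> i = k"
      using inv_equality[of "j \<otimes> i" k] by (simp add: inv_involution)
    \<comment> \<open>an involution cannot have trivial cube\<close>
    then have "k = \<one>"
      using cube[OF j i] by simp
    then show False
      using k by (simp add: mem_involutions_iff)
  qed
  with square show ?thesis
    by (simp add: mem_involutions_iff)
qed

lemma products_normal:
  assumes "involutions G \<noteq> {}"
  shows "(involutions G <#> involutions G) \<lhd> G"
proof -
  have carr: "i \<in> carrier G" "i \<otimes> i = \<one>" "inv i = i" if "i \<in> involutions G" for i
    using that by (simp_all add: mem_involutions_iff inv_involution)
  have mem: "i \<otimes> j \<in> involutions G <#> involutions G"
    if "i \<in> involutions G" "j \<in> involutions G" for i j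
    using that by (auto simp: set_mult_def)
  have "subgroup (involutions G <#> involutions G) G"
  proof (rule subgroupI)
    show "involutions G <#> involutions G \<subseteq> carrier G"
      using carr by (auto simp: set_mult_def)
    show "involutions G <#> involutions G \<noteq> {}"
      using assms mem by blast
  next
    fix n assume "n \<in> involutions G <#> involutions G"
    then obtain i j where "i \<in> involutions G" "j \<in> involutions G" "n = i \<otimes> j"
      by (auto simp: set_mult_def)
    then show "inv n \<in> involutions G <#> involutions G"
      using mem carr by (simp add: inv_mult_group)
  next
    fix n m assume "n \<in> involutions G <#> involutions G" "m \<in> involutions G <#> involutions G"
    then obtain i j k l where *: "i \<in> involutions G" "j \<in> involutions G" "n = i \<otimes> j"
      "k \<in> involutions G" "l \<in> involutions G" "m = k \<otimes> l"
      by (auto simp: set_mult_def)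
    then have "n \<otimes> m = (i \<otimes> j \<otimes> k) \<otimes> l"
      using carr by (simp add: m_assoc)
    then show "n \<otimes> m \<in> involutions G <#> involutions G"
      using mem[OF triple_mem] * by simp
  qed
  moreover have "g \<otimes> n \<otimes> inv g \<in> involutions G <#> involutions G"
    if g: "g \<in> carrier G" and n: "n \<in> involutions G <#> involutions G" for g n
  proof -
    obtain i j where ij: "i \<in> involutions G" "j \<in> involutions G" "n = i \<otimes> j"
      using n by (auto simp: set_mult_def)
    have "g \<otimes> n \<otimes> inv g = (g \<otimes> i \<otimes> inv g) \<otimes> (g \<otimes> j \<otimes> inv g)"
      using ij carr g by (simp add: m_assoc)
    then show ?thesis
      using mem[OF involutions_conj involutions_conj] ij g by simp
  qed
  ultimately show ?thesis
    by (simp add: normal_inv_iff)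
qed

end

section \<open>Involutions and their fixed points\<close>

context sharply_2_transitive
begin

lemma is_group: "group G"
  by (rule group_hom.axioms(1)[OF group_hom])

interpretation group G
  by (rule is_group)

lemma act_mult [simp]:
  "\<lbrakk>g \<in> carrier G; h \<in> carrier G; p \<in> E\<rbrakk> \<Longrightarrow> \<phi> (g \<otimes> h) p = \<phi> g (\<phi> h p)"
  by (rule composition_rule)

lemma act_one [simp]: "p \<in> E \<Longrightarrow> \<phi> \<one> p = p"
  by (simp flip: id_eq_one)

lemma act_closed [simp]: "\<lbrakk>g \<in> carrier G; p \<in> E\<rbrakk> \<Longrightarrow> \<phi> g p \<in> E"
  by (erule element_image) simp_all

lemma act_inv_eq:
  "\<lbrakk>g \<in> carrier G; p \<in> E; q \<in> E\<rbrakk> \<Longrightarrow> \<phi> (inv g) q = p \<longleftrightarrow> q = \<phi> g p"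
  using act_mult[of "inv g" g p] act_mult[of g "inv g" q] by auto

lemma act_eq_iff:
  "\<lbrakk>g \<in> carrier G; p \<in> E; q \<in> E\<rbrakk> \<Longrightarrow> \<phi> g p = \<phi> g q \<longleftrightarrow> p = q"
  using inj_prop[of g] by (auto simp: inj_on_eq_iff)

lemma eqI:
  assumes "g \<in> carrier G" "h \<in> carrier G" "p \<in> E" "q \<in> E" "p \<noteq> q"
    and "\<phi> g p = \<phi> h p" "\<phi> g q = \<phi> h q"
  shows "g = h"
proof -
  have "\<exists>!f. f \<in> carrier G \<and> \<phi> f p = \<phi> h p \<and> \<phi> f q = \<phi> h q"
    using assms(2-5) by (intro sharp) (simp_all add: act_eq_iff)
  with assms show ?thesis
    by blast
qed

lemma eq_one_if_fixes_two:
  assumes "g \<in> carrier G" "p \<in> E" "q \<in> E" "p \<noteq> q" "\<phi> g p = p" "\<phi> g q = q"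
  shows "g = \<one>"
  using assms by (intro eqI[of g \<one> p q]) auto

lemma act_involution_twice:
  assumes "i \<in> involutions G" "p \<in> E"
  shows "\<phi> i (\<phi> i p) = p"
  using assms by (simp add: mem_involutions_iff flip: act_mult)

lemma involution_fixpoint_unique:
  assumes "i \<in> involutions G" "p \<in> E" "q \<in> E" "\<phi> i p = p" "\<phi> i q = q"
  shows "p = q"
  using assms eq_one_if_fixes_two[of i p q] by (auto simp: mem_involutions_iff)

text \<open>The element that swaps two points is an involution, as its square fixes both of them.\<close>

lemma swapping_involution:
  assumes "p \<in> E" "q \<in> E" "p \<noteq> q"
  obtains i where "i \<in> involutions G" "\<phi> i p = q" "\<phi> i q = p"
proof -
  obtain i where i: "i \<in> carrier G" "\<phi> i p = q" "\<phi> i q = p"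
    using sharp[of p q q p] assms by blast
  have "i \<otimes> i = \<one>"
    using i assms by (intro eq_one_if_fixes_two[of _ p q]) auto
  moreover have "i \<noteq> \<one>"
    using i assms by auto
  ultimately show thesis
    using i that by (simp add: mem_involutions_iff)
qed

text \<open>
  An involution is determined by any pair of points that it swaps, so sharpness makes all
  involutions conjugate; the conjugating element can be chosen with a prescribed value at a point
  that the first involution moves.
\<close>

lemma involutions_conjugate_at:
  assumes i: "i \<in> involutions G" and j: "j \<in> involutions G"
    and p: "p \<in> E" "\<phi> i p \<noteq> p" and q: "q \<in> E" "\<phi> j q \<noteq> q"
  obtains g where "g \<in> carrier G" "\<phi> g p = q" "j = g \<otimes> i \<otimes> inv g"
proof -
  have [simp]: "i \<in> carrier G" "j \<in> carrier G"
    using i j by (simp_all add: mem_involutions_iff)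
  obtain g where g: "g \<in> carrier G" "\<phi> g p = q" "\<phi> g (\<phi> i p) = \<phi> j q"
    using sharp[of p "\<phi> i p" q "\<phi> j q"] p q by (metis act_closed \<open>i \<in> carrier G\<close> \<open>j \<in> carrier G\<close>)
  have "\<phi> (inv g) q = p" "\<phi> (inv g) (\<phi> j q) = \<phi> i p"
    using g p q by (simp_all add: act_inv_eq)
  then have "j = g \<otimes> i \<otimes> inv g"
    using g p q act_involution_twice[OF i] act_involution_twice[OF j]
    by (intro eqI[of _ _ q "\<phi> j q"]) simp_all
  with g that show thesis
    by blast
qed

lemma involution_moves:
  assumes "i \<in> involutions G" "p \<in> E" "q \<in> E" "p \<noteq> q"
  obtains r where "r \<in> E" "\<phi> i r \<noteq> r"
  using assms involution_fixpoint_unique by metis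

lemma involution_has_fixpoint:
  assumes t: "t \<in> involutions G" "x \<in> E" "\<phi> t x = x" and y: "y \<in> E" "y \<noteq> x"
    and j: "j \<in> involutions G"
  obtains p where "p \<in> E" "\<phi> j p = p"
proof -
  have ty: "\<phi> t y \<noteq> y"
    using t y involution_fixpoint_unique by blast
  obtain q where q: "q \<in> E" "\<phi> j q \<noteq> q"
    using involution_moves[OF j \<open>x \<in> E\<close> y(1)] y(2) by metis
  obtain g where g: "g \<in> carrier G" "j = g \<otimes> t \<otimes> inv g"
    using involutions_conjugate_at[OF t(1) j y(1) ty q] by metis
  have "t \<in> carrier G"
    using t by (simp add: mem_involutions_iff)
  have "\<phi> (inv g) (\<phi> g x) = x"
    using g t by (simp add: act_inv_eq)
  then have "\<phi> j (\<phi> g x) = \<phi> g x"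
    using g t \<open>t \<in> carrier G\<close> by simp
  then show thesis
    using that[of "\<phi> g x"] g t by simp
qed

text \<open>
  If \<open>i\<close> and \<open>j\<close> both fix \<open>p\<close>, then some \<open>g\<close> conjugates \<open>i\<close> to \<open>j\<close> and fixes a given second point
  \<open>q\<close>; but \<open>g\<close> also maps the fixed point of \<open>i\<close> to that of \<open>j\<close>, so it fixes \<open>p\<close> as well and is
  trivial.
\<close>

lemma involution_eq_if_common_fixpoint:
  assumes i: "i \<in> involutions G" "\<phi> i p = p" and j: "j \<in> involutions G" "\<phi> j p = p"
    and p: "p \<in> E" and q: "q \<in> E" "q \<noteq> p"
  shows "i = j"
proof -
  have [simp]: "i \<in> carrier G" "j \<in> carrier G"
    using i j by (simp_all add: mem_involutions_iff)
  have "\<phi> i q \<noteq> q" "\<phi> j q \<noteq> q"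
    using i j p q involution_fixpoint_unique by blast+
  then obtain g where g: "g \<in> carrier G" "\<phi> g q = q" "j = g \<otimes> i \<otimes> inv g"
    using involutions_conjugate_at[OF i(1) j(1) q(1) _ q(1)] by metis
  have "\<phi> (inv g) (\<phi> g p) = p"
    using g p by (simp add: act_inv_eq)
  then have "\<phi> j (\<phi> g p) = \<phi> g p"
    using g p i by simp
  then have "\<phi> g p = p"
    by (rule involution_fixpoint_unique[OF j(1) act_closed[OF g(1) p] p _ j(2)])
  then have "g = \<one>"
    using eq_one_if_fixes_two[OF g(1) p q(1)] q g by auto
  then show ?thesis
    using g by simp
qed

text \<open>What commutes with an involution permutes its fixed points, of which there is only one.\<close>

lemma centralizer_fixes_fixpoint:
  assumes i: "i \<in> involutions G" "p \<in> E" "\<phi> i p = p"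
    and c: "c \<in> carrier G" "i \<otimes> c = c \<otimes> i"
  shows "\<phi> c p = p"
proof -
  have "i \<in> carrier G"
    using i by (simp add: mem_involutions_iff)
  moreover have "\<phi> (i \<otimes> c) p = \<phi> (c \<otimes> i) p"
    by (simp only: c(2))
  ultimately have "\<phi> i (\<phi> c p) = \<phi> c p"
    using c(1) i by simp
  then show ?thesis
    by (rule involution_fixpoint_unique[OF i(1) act_closed[OF c(1) i(2)] i(2) _ i(3)])
qed

lemma centralizer_of_two_involutions:
  assumes t: "t \<in> involutions G" "x \<in> E" "\<phi> t x = x" and y: "y \<in> E" "y \<noteq> x"
    and ij: "i \<in> involutions G" "j \<in> involutions G" "i \<noteq> j"
    and c: "c \<in> carrier G" "i \<otimes> c = c \<otimes> i" "j \<otimes> c = c \<otimes> j"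
  shows "c = \<one>"
proof -
  obtain p where p: "p \<in> E" "\<phi> i p = p"
    using involution_has_fixpoint[OF t y ij(1)] .
  obtain q where q: "q \<in> E" "\<phi> j q = q"
    using involution_has_fixpoint[OF t y ij(2)] .
  obtain r where "r \<in> E" "r \<noteq> p"
    using t(2) y by blast
  then have "p \<noteq> q"
    using involution_eq_if_common_fixpoint[OF ij(1) p(2) ij(2) _ p(1)] ij(3) q by blast
  moreover have "\<phi> c p = p"
    using centralizer_fixes_fixpoint[OF ij(1) p c(1,2)] .
  moreover have "\<phi> c q = q"
    using centralizer_fixes_fixpoint[OF ij(2) q c(1,3)] .
  ultimately show ?thesis
    using eq_one_if_fixes_two[OF c(1) p(1) q(1)] by blast
qed

text \<open>
  Both \<open>i\<close> and \<open>j\<close> invert \<open>n = i j\<close>, so they permute the fixed points of \<open>n\<close>. If \<open>n \<noteq> \<one>\<close>, the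
  point \<open>x\<close> is the only one, so both \<open>i\<close> and \<open>j\<close> fix it and they coincide, which is absurd.
\<close>

lemma product_fixing_point:
  assumes i: "i \<in> involutions G" and j: "j \<in> involutions G"
    and x: "x \<in> E" "\<phi> (i \<otimes> j) x = x" and y: "y \<in> E" "y \<noteq> x"
  shows "i \<otimes> j = \<one>"
proof (rule ccontr)
  assume n: "i \<otimes> j \<noteq> \<one>"
  have [simp]: "i \<in> carrier G" "j \<in> carrier G" and "i \<otimes> i = \<one>"
    using i j by (simp_all add: mem_involutions_iff)
  have ij: "\<phi> i (\<phi> j x) = x"
    using x by simp
  then have ji: "\<phi> j x = \<phi> i x"
    using act_involution_twice[OF i, of "\<phi> j x"] x by simp
  then have "\<phi> (i \<otimes> j) (\<phi> i x) = \<phi> i x"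
    using act_involution_twice[OF j x(1)] x by simp
  then have "\<phi> i x = x"
    using eq_one_if_fixes_two[of "i \<otimes> j" x "\<phi> i x"] n x by fastforce
  then have "i = j"
    using involution_eq_if_common_fixpoint[OF i _ j _ x(1) y] ji by simp
  with n \<open>i \<otimes> i = \<one>\<close> show False
    by simp
qed

text \<open>
  If \<open>g\<close> maps \<open>x\<close> to \<open>y \<noteq> x\<close>, then \<open>k t\<close> does so too, where \<open>t\<close> is an involution fixing \<open>x\<close> and
  \<open>k\<close> swaps \<open>x\<close> and \<open>y\<close>.
\<close>

lemma products_times_stabilizer:
  assumes t: "t \<in> involutions G" "\<phi> t x = x" and x: "x \<in> E"
  shows "carrier G = (involutions G <#> involutions G) <#> stabilizer G \<phi> x"
proof
  have carr: "i \<in> carrier G" if "i \<in> involutions G" for i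
    using that by (simp add: mem_involutions_iff)
  show "(involutions G <#> involutions G) <#> stabilizer G \<phi> x \<subseteq> carrier G"
    using carr by (auto simp: set_mult_def stabilizer_def)
  show "carrier G \<subseteq> (involutions G <#> involutions G) <#> stabilizer G \<phi> x"
  proof
    fix g assume g: "g \<in> carrier G"
    have "\<exists>k \<in> involutions G. \<phi> (k \<otimes> t) x = \<phi> g x"
    proof (cases "\<phi> g x = x")
      case True
      then show ?thesis
        using t x carr by (intro bexI[of _ t]) auto
    next
      case False
      obtain k where "k \<in> involutions G" "\<phi> k x = \<phi> g x"
        using swapping_involution[of x "\<phi> g x"] False g x by (metis act_closed)
      then show ?thesis
        using t x carr by (intro bexI[of _ k]) auto
    qed
    then obtain k where k: "k \<in> involutions G" "\<phi> (k \<otimes> t) x = \<phi> g x"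
      by blast
    let ?n = "k \<otimes> t"
    have n: "?n \<in> carrier G" "?n \<in> involutions G <#> involutions G"
      using k t carr by (auto simp: set_mult_def)
    have "\<phi> (inv ?n) (\<phi> g x) = x"
      using act_inv_eq[OF n(1) x, of "\<phi> g x"] g x k by simp
    then have "inv ?n \<otimes> g \<in> stabilizer G \<phi> x"
      using n(1) g x by (simp add: stabilizer_def)
    moreover have "g = ?n \<otimes> (inv ?n \<otimes> g)"
      using n(1) g by simp
    ultimately show "g \<in> (involutions G <#> involutions G) <#> stabilizer G \<phi> x"
      using n(2) unfolding set_mult_def by blast
  qed
qed

end

section \<open>Splitting in characteristic three\<close>

theorem theorem1:
  fixes G :: "('a, 'm) monoid_scheme" (structure)
    and E :: "'b set"
    and \<phi> :: "'a \<Rightarrow> 'b \<Rightarrow> 'b"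
    and x :: 'b
  assumes "sharply_2_transitive G E \<phi>"
    and "infinite E \<or> card E \<ge> 3"
    and "x \<in> E"
    and "has_char G \<phi> x 3"
  shows "has_normal_complement G (stabilizer G \<phi> x)"
proof -
  interpret sharply_2_transitive G E \<phi>
    by fact
  interpret group G
    by (rule is_group)
  let ?I = "involutions G"
  have "\<not> E \<subseteq> {x}"
    using assms(2) by (auto dest: finite_subset card_mono[rotated])
  then obtain y where y: "y \<in> E" "y \<noteq> x"
    by blast
  have nonempty: "stabilizer G \<phi> x \<inter> ?I \<noteq> {}"
    and ord3: "\<forall>g \<in> (?I <#> ?I) - {\<one>}. ord g = 3"
    using assms(4) by (auto simp: has_char_def split: if_splits)
  obtain t where t: "t \<in> ?I" "\<phi> t x = x"
    using nonempty by (auto simp: stabilizer_def)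
  interpret cubic_involutions G
  proof
    fix i j assume ij: "i \<in> ?I" "j \<in> ?I"
    then have carr: "i \<otimes> j \<in> carrier G"
      by (simp add: mem_involutions_iff)
    have "i \<otimes> j = \<one> \<or> ord (i \<otimes> j) = 3"
      using ord3 ij by (auto simp: set_mult_def)
    then have "(i \<otimes> j) [^] (3 :: nat) = \<one>"
      using pow_ord_eq_1[OF carr] by auto
    then show "(i \<otimes> j) \<otimes> ((i \<otimes> j) \<otimes> (i \<otimes> j)) = \<one>"
      using carr by (simp add: numeral_3_eq_3 m_assoc)
  next
    fix i j c assume "i \<in> ?I" "j \<in> ?I" "i \<noteq> j" "c \<in> carrier G"
      "i \<otimes> c = c \<otimes> i" "j \<otimes> c = c \<otimes> j"
    then show "c = \<one>"
      using centralizer_of_two_involutions[OF t(1) assms(3) t(2) y] by blast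
  qed
  have "(?I <#> ?I) \<lhd> G"
    using t by (intro products_normal) blast
  moreover have "carrier G = (?I <#> ?I) <#> stabilizer G \<phi> x"
    using products_times_stabilizer[OF t assms(3)] .
  moreover have "(?I <#> ?I) \<inter> stabilizer G \<phi> x = {\<one>}"
  proof
    show "(?I <#> ?I) \<inter> stabilizer G \<phi> x \<subseteq> {\<one>}"
      using product_fixing_point[OF _ _ assms(3) _ y] by (auto simp: set_mult_def stabilizer_def)
    have "t \<otimes> t = \<one>"
      using t by (simp add: mem_involutions_iff)
    then show "{\<one>} \<subseteq> (?I <#> ?I) \<inter> stabilizer G \<phi> x"
      using t assms(3) by (force simp: set_mult_def stabilizer_def)
  qed
  ultimately show ?thesis
    unfolding has_normal_complement_def by blast
qed

end
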